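(* Let $M\in\mathbb C^{n\times n}$ and $\varepsilon>0$. Let $$\Delta_{\rm opt}=\operatorname{diag}(\delta_1 I_{r_1},\ldots,\delta_S I_{r_S},\Delta_1,\ldots,\Delta_F)\in\mathbb B^*,\qquad \|\Delta_{\rm opt}\|_2=1,$$ be a local extremizer of $\Lambda_\varepsilon^{\mathbb B^*}(M)$. Assume that $\varepsilon M\Delta_{\rm opt}$ has a simple largest eigenvalue $\lambda=|\lambda|e^{\mathbf i\theta}$, with right and left eigenvectors $x$ and $y$ scaled such that $e^{\mathbf i\theta}y^*x>0$. Let $z=M^*y$ and partition $$x=(x_1^{\rm T},\ldots,x_{S+F}^{\rm T})^{\rm T},\qquad z=(z_1^{\rm T},\ldots,z_{S+F}^{\rm T})^{\rm T}$$ such that the size of $x_k,z_k$ equals the size of the $k$-th diagonal block of $\Delta_{\rm opt}$. Assume that $$\|z_{S+h}\|_2\cdot\|x_{S+h}\|_2\neq0\quad\text{for all }h=1,\ldots,F.$$ Then every block $\Delta_h$ ($h=1,\ldots,F$) has a singular value $1$ with associated (left and right) singular vectors $u_h=\gamma_h z_{S+h}/\|z_{S+h}\|_2$ and $v_h=\gamma_h x_{S+h}/\|x_{S+h}\|_2$ for some $\gamma_h\in\mathbb C$ with $|\gamma_h|=1$. Moreover, the matrix $$\Delta_*=\operatorname{diag}(\delta_1 I_{r_1},\ldots,\delta_S I_{r_S},u_1v_1^*,\ldots,u_Fv_F^* )$$ is also a local extremizer, i.e. $\rho(\varepsilon M\Delta_{\rm opt})=\rho(\varepsilon M\Delta_*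 )$.
   Context: Fix nonnegative integers $S,F$ and positive integers $r_1,\ldots,r_S,m_1,\ldots,m_F$ with $\sum_i r_i+\sum_j m_j=n$. The purely complex perturbation set is $$\mathbb B^*=\{\operatorname{diag}(\delta_1 I_{r_1},\ldots,\delta_S I_{r_S},\Delta_1,\ldots,\Delta_F):\ \delta_i\in\mathbb C,\ \Delta_j\in\mathbb C^{m_j\times m_j}\}.$$ $\|\cdot\|_2$ is the spectral norm (Euclidean norm for vectors), $\Lambda(\cdot)$ the spectrum, $\rho(\cdot)$ the spectral radius, $\mathbf i$ the imaginary unit. The structured spectral value set is $$\Lambda_\varepsilon^{\mathbb B^*}(M)=\{\lambda\in\Lambda(\varepsilon M\Delta):\ \Delta\in\mathbb B^*,\ \|\Delta\|_2\le 1\}.$$ A "largest eigenvalue" of a matrix is an eigenvalue whose modulus equals the spectral radius. A matrix $\Delta\in\mathbb B^*$ is called a local extremizer of $\Lambda_\varepsilon^{\mathbb B^*}(M)$ if $\|\Delta\|_2\le1$ and $\varepsilon M\Delta$ has a largest eigenvalue that locally maximizes the modulus of $\Lambda_\varepsilon^{\mathbb B^*}(M)$ (i.e. it is a local maximizer of $w\mapsto|w|$ on this set). A left eigenvector $y\ne0$ of $C$ for $\lambda$ satisfies $y^*(C-\lambda I)=0$. Unit vectors $u,v$ are left and right singular vectors of $A$ for the singular value $1$ if $Av=u$ and $A^*u=v$. *)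

theory Defs
  imports
    "Jordan_Normal_Form.Spectral_Radius"
    "Jordan_Normal_Form.Schur_Decomposition"
begin

text \<open>
  Vectors and matrices are those of Jordan_Normal_Form; \<open>v \<bullet>c w\<close> is
  \<open>\<Sum>i. v i * cnj (w i)\<close>, that is \<open>w\<^sup>* v\<close>, and \<open>0 < c\<close> for a complex number \<open>c\<close>
  (theory Complex_Order) says that \<open>c\<close> is real and positive.
\<close>

definition vnorm :: "complex vec \<Rightarrow> real" where
  "vnorm v = sqrt (\<Sum>i<dim_vec v. (cmod (v $ i))\<^sup>2)"

definition spec_norm :: "complex mat \<Rightarrow> real" where
  "spec_norm A = (SUP v\<in>{v \<in> carrier_vec (dim_col A). vnorm v \<le> 1}. vnorm (A *\<^sub>v v))"

definition outer :: "complex vec \<Rightarrow> complex vec \<Rightarrow> complex mat" where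
  "outer u v = mat (dim_vec u) (dim_vec v) (\<lambda>(i, j). u $ i * cnj (v $ j))"

definition left_eigenvector :: "complex mat \<Rightarrow> complex vec \<Rightarrow> complex \<Rightarrow> bool" where
  "left_eigenvector C y l \<longleftrightarrow>
     y \<in> carrier_vec (dim_row C) \<and> y \<noteq> 0\<^sub>v (dim_row C) \<and>
     mat_of_row (conjugate y) * (C - l \<cdot>\<^sub>m 1\<^sub>m (dim_row C)) = 0\<^sub>m 1 (dim_row C)"

definition singular_vectors_1 :: "complex mat \<Rightarrow> complex vec \<Rightarrow> complex vec \<Rightarrow> bool" where
  "singular_vectors_1 A u v \<longleftrightarrow>
     u \<in> carrier_vec (dim_row A) \<and> v \<in> carrier_vec (dim_col A) \<and>
     vnorm u = 1 \<and> vnorm v = 1 \<and>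
     A *\<^sub>v v = u \<and> mat_adjoint A *\<^sub>v u = v"

text \<open>
  The block structure is given by the lists \<open>rs = [r\<^sub>1, \<dots>, r\<^sub>S]\<close> and
  \<open>ms = [m\<^sub>1, \<dots>, m\<^sub>F]\<close>, either of which may be empty; all list positions are
  counted from 0.
\<close>

definition block_parts :: "nat list \<Rightarrow> nat list \<Rightarrow> complex list \<Rightarrow> complex mat list \<Rightarrow> bool" where
  "block_parts rs ms ds Ds \<longleftrightarrow>
     length ds = length rs \<and> length Ds = length ms \<and>
     (\<forall>j<length ms. Ds ! j \<in> carrier_mat (ms ! j) (ms ! j))"

definition block_pert :: "nat list \<Rightarrow> complex list \<Rightarrow> complex mat list \<Rightarrow> complex mat" where
  "block_pert rs ds Ds = diag_block_mat (map2 (\<lambda>d r. d \<cdot>\<^sub>m 1\<^sub>m r) ds rs @ Ds)"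

definition pert_set :: "nat list \<Rightarrow> nat list \<Rightarrow> complex mat set" where
  "pert_set rs ms = {block_pert rs ds Ds | ds Ds. block_parts rs ms ds Ds}"

text \<open>The \<open>k\<close>-th piece of \<open>x\<close> in the partition into consecutive pieces of sizes \<open>ks\<close>.\<close>

definition vec_block :: "nat list \<Rightarrow> complex vec \<Rightarrow> nat \<Rightarrow> complex vec" where
  "vec_block ks x k = vec (ks ! k) (\<lambda>i. x $ (sum_list (take k ks) + i))"

definition scaled_prod :: "real \<Rightarrow> complex mat \<Rightarrow> complex mat \<Rightarrow> complex mat" where
  "scaled_prod e M D = complex_of_real e \<cdot>\<^sub>m (M * D)"

definition value_set :: "nat list \<Rightarrow> nat list \<Rightarrow> real \<Rightarrow> complex mat \<Rightarrow> complex set" where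
  "value_set rs ms e M =
     {l. \<exists>D \<in> pert_set rs ms. spec_norm D \<le> 1 \<and> l \<in> spectrum (scaled_prod e M D)}"

definition largest_eigenvalue :: "complex mat \<Rightarrow> complex \<Rightarrow> bool" where
  "largest_eigenvalue A l \<longleftrightarrow> eigenvalue A l \<and> cmod l = spectral_radius A"

definition local_max_modulus :: "complex set \<Rightarrow> complex \<Rightarrow> bool" where
  "local_max_modulus X l \<longleftrightarrow>
     l \<in> X \<and> (\<exists>d>0. \<forall>w\<in>X. dist w l < d \<longrightarrow> cmod w \<le> cmod l)"

definition local_extremizer ::
    "nat list \<Rightarrow> nat list \<Rightarrow> real \<Rightarrow> complex mat \<Rightarrow> complex mat \<Rightarrow> bool" where
  "local_extremizer rs ms e M D \<longleftrightarrow>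
     D \<in> pert_set rs ms \<and> spec_norm D \<le> 1 \<and>
     (\<exists>l. largest_eigenvalue (scaled_prod e M D) l \<and>
          local_max_modulus (value_set rs ms e M) l)"

end

theory Submission
  imports Defs "HOL-Analysis.L2_Norm"
begin

text \<open>
  Write \<open>D\<close> for the given extremizer. If \<open>w\<close> is an eigenvalue of \<open>\<epsilon>MD'\<close> and \<open>\<bar>c\<bar> \<le> 1\<close>, then \<open>cw\<close>
  is an eigenvalue of \<open>\<epsilon>M(cD')\<close>, so the value set is a disc about the origin and a local maximizer
  of the modulus on it is a global one. Hence no eigenvalue of any \<open>\<epsilon>MD'\<close> with an admissible \<open>D'\<close>
  exceeds \<open>\<bar>\<lambda>\<bar>\<close> (\<open>value_set_scale\<close>, \<open>local_max_modulus_imp_global\<close>). This is what turns the last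
  claim into a statement about one eigenvector: once \<open>\<lambda>\<close> is an eigenvalue of \<open>\<epsilon>M\<Delta>\<^sub>*\<close>, it is
  automatically a largest one.

  The admissible matrices form a convex set. Moving from \<open>D\<close> towards an admissible \<open>E\<close>, the
  simple eigenvalue \<open>\<lambda>\<close> has the derivative \<open>\<epsilon> z\<^sup>*(E - D)x / (y\<^sup>*x)\<close>, and its modulus cannot grow to
  first order; the scaling \<open>e\<^bsup>i\<theta>\<^esup>y\<^sup>*x > 0\<close> makes this say that \<open>D\<close> maximizes \<open>Re z\<^sup>*Ex\<close> over all
  admissible \<open>E\<close> (\<open>Re_first_order_nonpos\<close>, \<open>Re_inner_maximal\<close>). This functional is a sum over the
  diagonal blocks, so every full block maximizes its own summand among the contractions
  (\<open>block_pert_update_maximal\<close>). The competitor \<open>uv\<^sup>*\<close>, with \<open>u\<close> and \<open>v\<close> the normalized pieces of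
  \<open>z\<close> and \<open>x\<close>, attains the Cauchy-Schwarz bound; the block must attain it too, and the equality case
  says that \<open>u\<close> and \<open>v\<close> are singular vectors for the singular value 1 (\<open>singular_vectors_1I\<close>).
  In particular all the \<open>\<gamma>\<^sub>h\<close> can be taken to be 1. Finally each block and its rank-one replacement
  agree on the piece of \<open>x\<close>, so \<open>\<Delta>\<^sub>*x = Dx\<close> and \<open>\<lambda>\<close> is an eigenvalue of \<open>\<epsilon>M\<Delta>\<^sub>*\<close>.
\<close>

section \<open>First-order perturbation of a simple eigenvalue\<close>

lemma tendsto_det:
  fixes X :: "'t \<Rightarrow> complex mat"
  assumes X: "\<And>t. X t \<in> carrier_mat n n" and Y: "Y \<in> carrier_mat n n"
    and lim: "\<And>i j. i < n \<Longrightarrow> j < n \<Longrightarrow> ((\<lambda>t. X t $$ (i, j)) \<longlongrightarrow> Y $$ (i, j)) F"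
  shows "((\<lambda>t. det (X t)) \<longlongrightarrow> det Y) F"
  unfolding det_def'[OF X] det_def'[OF Y]
  by (intro tendsto_sum tendsto_mult tendsto_const tendsto_prod lim)
     (auto dest: permutes_in_image)

lemma tendsto_adj_mat:
  fixes X :: "'t \<Rightarrow> complex mat"
  assumes X: "\<And>t. X t \<in> carrier_mat n n" and Y: "Y \<in> carrier_mat n n"
    and lim: "\<And>i j. i < n \<Longrightarrow> j < n \<Longrightarrow> ((\<lambda>t. X t $$ (i, j)) \<longlongrightarrow> Y $$ (i, j)) F"
    and i: "i < n" and j: "j < n"
  shows "((\<lambda>t. adj_mat (X t) $$ (i, j)) \<longlongrightarrow> adj_mat Y $$ (i, j)) F"
proof -
  have dims: "\<And>t. dim_row (X t) = n" "\<And>t. dim_col (X t) = n" "dim_row Y = n" "dim_col Y = n"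
    using X Y by auto
  have "((\<lambda>t. det (mat_delete (X t) j i)) \<longlongrightarrow> det (mat_delete Y j i)) F"
    by (rule tendsto_det[of _ "n - 1"])
       (use i j in \<open>auto simp: mat_delete_def dims intro!: lim\<close>)
  then show ?thesis
    using i j by (auto simp: adj_mat_def cofactor_def dims intro!: tendsto_mult)
qed

lemma poly_char_poly:
  fixes A :: "complex mat"
  assumes A: "A \<in> carrier_mat n n"
  shows "poly (char_poly A) k = det (k \<cdot>\<^sub>m 1\<^sub>m n - A)"
proof -
  have "- (char_matrix A k) = k \<cdot>\<^sub>m 1\<^sub>m n - A"
    using A by (intro eq_matI) (auto simp: char_matrix_def)
  then show ?thesis by (simp add: char_poly_matrix[OF A])
qed

text \<open>
  At the eigenvalue the adjugate of \<open>k - A\<close> acts on the eigenvector as the derivative of the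
  characteristic polynomial, which does not vanish at a simple root. For \<open>k \<noteq> l\<close> this holds with the
  difference quotient \<open>q k\<close> in place of the derivative, because \<open>(k - A) x = (k - l) x\<close> and
  \<open>adj (k - A) (k - A) = det (k - A)\<close>; then let \<open>k\<close> tend to \<open>l\<close>.
\<close>

lemma adj_mat_simple_eigenvector:
  fixes A :: "complex mat"
  assumes A: "A \<in> carrier_mat n n" and x: "x \<in> carrier_vec n"
    and ev: "A *\<^sub>v x = l \<cdot>\<^sub>v x"
    and simple: "order l (char_poly A) = 1"
  obtains P where "P \<noteq> 0" and "adj_mat (l \<cdot>\<^sub>m 1\<^sub>m n - A) *\<^sub>v x = P \<cdot>\<^sub>v x"
proof -
  let ?R = "\<lambda>k. k \<cdot>\<^sub>m 1\<^sub>m n - A"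
  have R: "?R k \<in> carrier_mat n n" for k using A by auto
  have p0: "char_poly A \<noteq> 0" using simple by (metis degree_monic_char_poly[OF A] leading_coeff_0_iff zero_neq_one)
  obtain q where q: "char_poly A = [:- l, 1:] * q" and ql: "\<not> [:- l, 1:] dvd q"
    using order_decomp[OF p0, of l] simple by auto
  have ql: "poly q l \<noteq> 0" using ql by (simp add: poly_eq_0_iff_dvd)
  have Rx: "?R k *\<^sub>v x = (k - l) \<cdot>\<^sub>v x" for k
  proof -
    have "?R k *\<^sub>v x = (k \<cdot>\<^sub>m 1\<^sub>m n) *\<^sub>v x - A *\<^sub>v x"
      using A x by (intro minus_mult_distrib_mat_vec) auto
    also have "\<dots> = (k - l) \<cdot>\<^sub>v x" unfolding ev using x
      by (auto intro!: eq_vecI simp: algebra_simps)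
    finally show ?thesis .
  qed
  have off: "adj_mat (?R k) *\<^sub>v x = poly q k \<cdot>\<^sub>v x" if "k \<noteq> l" for k
  proof -
    have adj: "adj_mat (?R k) \<in> carrier_mat n n" by (rule adj_mat(1)[OF R])
    have "(k - l) \<cdot>\<^sub>v (adj_mat (?R k) *\<^sub>v x) = adj_mat (?R k) *\<^sub>v (?R k *\<^sub>v x)"
      unfolding Rx using adj x by (simp add: mult_mat_vec)
    also have "\<dots> = (adj_mat (?R k) * ?R k) *\<^sub>v x"
      using assoc_mult_mat_vec[OF adj R x] by simp
    also have "\<dots> = det (?R k) \<cdot>\<^sub>v x"
      unfolding adj_mat(3)[OF R] using x by (auto intro!: eq_vecI)
    also have "\<dots> = (k - l) \<cdot>\<^sub>v (poly q k \<cdot>\<^sub>v x)"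
      unfolding poly_char_poly[OF A, symmetric] q by (simp add: smult_smult_assoc algebra_simps)
    finally have eq: "(k - l) \<cdot>\<^sub>v (adj_mat (?R k) *\<^sub>v x) = (k - l) \<cdot>\<^sub>v (poly q k \<cdot>\<^sub>v x)" .
    have "inverse (k - l) \<cdot>\<^sub>v ((k - l) \<cdot>\<^sub>v v) = v" for v
      using that by (simp add: smult_smult_assoc)
    then show ?thesis using eq by metis
  qed
  have "adj_mat (?R l) *\<^sub>v x = poly q l \<cdot>\<^sub>v x"
  proof (rule eq_vecI)
    fix i assume "i < dim_vec (poly q l \<cdot>\<^sub>v x)"
    then have i: "i < n" using x by auto
    have entry: "(adj_mat (?R k) *\<^sub>v x) $ i = (\<Sum>j<n. adj_mat (?R k) $$ (i, j) * x $ j)" for k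
      using adj_mat(1)[OF R, of k] i x
      by (auto simp: scalar_prod_def atLeast0LessThan intro!: sum.cong)
    have "((\<lambda>k. (adj_mat (?R k) *\<^sub>v x) $ i) \<longlongrightarrow> (adj_mat (?R l) *\<^sub>v x) $ i) (at l)"
      unfolding entry
      by (intro tendsto_sum tendsto_mult tendsto_const tendsto_adj_mat[OF R R])
         (use A i in \<open>auto intro!: tendsto_eq_intros\<close>)
    moreover have "((\<lambda>k. (adj_mat (?R k) *\<^sub>v x) $ i) \<longlongrightarrow> poly q l * x $ i) (at l)"
    proof (rule Lim_transform_eventually)
      show "((\<lambda>k. poly q k * x $ i) \<longlongrightarrow> poly q l * x $ i) (at l)"
        by (auto intro!: tendsto_eq_intros poly_isCont[unfolded isCont_def])
      show "\<forall>\<^sub>F k in at l. poly q k * x $ i = (adj_mat (?R k) *\<^sub>v x) $ i"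
        by (rule eventually_at_filter[THEN iffD2], rule always_eventually) (use off i x in auto)
    qed
    ultimately show "(adj_mat (?R l) *\<^sub>v x) $ i = (poly q l \<cdot>\<^sub>v x) $ i"
      using i x tendsto_unique[of "at l"] by auto
  qed (use adj_mat(1)[OF R, of l] x in auto)
  then show thesis using ql that by blast
qed

lemma cmod_le_cmod_shift:
  fixes e w :: complex and s :: real
  assumes "0 \<le> Re (cnj e * w)" "0 \<le> s"
  shows "cmod w \<le> cmod (w + s * e)"
proof -
  have "(cmod (w + s * e))\<^sup>2 = (cmod w)\<^sup>2 + 2 * s * Re (cnj e * w) + s\<^sup>2 * (cmod e)\<^sup>2"
    unfolding cmod_power2 by (simp add: power2_eq_square algebra_simps)
  then have "(cmod w)\<^sup>2 \<le> (cmod (w + s * e))\<^sup>2" using assms by simp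
  then show ?thesis by (simp add: power2_le_iff_abs_le)
qed

text \<open>
  If all roots lie in a disc about the origin, the modulus of the characteristic polynomial does not
  decrease along a ray leaving the disc radially, since the distance to each root does not decrease.
\<close>

lemma cmod_det_mono_outside:
  fixes A :: "complex mat"
  assumes A: "A \<in> carrier_mat n n" and e: "cmod e = 1" and s: "0 \<le> s"
    and bound: "\<And>a. eigenvalue A a \<Longrightarrow> cmod a \<le> r"
  shows "cmod (det ((of_real r * e) \<cdot>\<^sub>m 1\<^sub>m n - A))
       \<le> cmod (det ((of_real r * e + of_real s * e) \<cdot>\<^sub>m 1\<^sub>m n - A))"
proof -
  obtain as where as: "char_poly A = (\<Prod>a\<leftarrow>as. [:- a, 1:])"
    using char_poly_factorized[OF A] by auto
  have le: "cmod (of_real r * e - a) \<le> cmod (of_real r * e + of_real s * e - a)" if "a \<in> set as" for a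
  proof -
    have "poly (char_poly A) a = 0"
      using that unfolding as poly_prod_list prod_list_zero_iff by (auto simp: image_iff)
    then have "cmod a \<le> r" using bound eigenvalue_root_char_poly[OF A] by blast
    moreover have "Re (cnj e * a) \<le> cmod a"
      using complex_Re_le_cmod[of "cnj e * a"] e by (simp add: norm_mult)
    moreover have "cnj e * e = 1"
      using complex_norm_square[of e] e by (simp add: mult.commute)
    then have "cnj e * (of_real r * e - a) = of_real r - cnj e * a"
      by (simp add: algebra_simps)
    ultimately have "0 \<le> Re (cnj e * (of_real r * e - a))" by simp
    from cmod_le_cmod_shift[OF this s] show ?thesis by (simp add: algebra_simps)
  qed
  have cmod_poly: "cmod (poly (char_poly A) k) = (\<Prod>a\<leftarrow>as. cmod (k - a))" for k
    unfolding as poly_prod_list by (induction as) (auto simp: norm_mult)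
  have "(\<Prod>a\<leftarrow>as. cmod (of_real r * e - a)) \<le> (\<Prod>a\<leftarrow>as. cmod (of_real r * e + of_real s * e - a))"
    using le by (induction as) (auto intro!: mult_mono prod_list_nonneg)
  then show ?thesis
    unfolding poly_char_poly[OF A, symmetric] cmod_poly .
qed

lemma left_eigenvector_inner:
  assumes A: "A \<in> carrier_mat n n" and y: "left_eigenvector A y l" and w: "w \<in> carrier_vec n"
  shows "(A *\<^sub>v w) \<bullet>c y = l * (w \<bullet>c y)"
proof -
  have yc: "y \<in> carrier_vec n" using y A by (simp add: left_eigenvector_def)
  let ?X = "A - l \<cdot>\<^sub>m 1\<^sub>m n" and ?Y = "mat_of_row (conjugate y)"
  have X: "?X \<in> carrier_mat n n" and Y: "?Y \<in> carrier_mat 1 n" using A yc by auto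
  have "?Y * ?X = 0\<^sub>m 1 n" using y A by (simp add: left_eigenvector_def)
  moreover have "0\<^sub>m 1 n *\<^sub>v w = 0\<^sub>v 1" using w by (intro eq_vecI) auto
  ultimately have "?Y *\<^sub>v (?X *\<^sub>v w) = 0\<^sub>v 1"
    using assoc_mult_mat_vec[OF Y X w] by simp
  then have "(?Y *\<^sub>v (?X *\<^sub>v w)) $ 0 = 0" by simp
  then have "conjugate y \<bullet> (?X *\<^sub>v w) = 0" using Y by simp
  moreover have "?X *\<^sub>v w = A *\<^sub>v w - l \<cdot>\<^sub>v w"
    using A w by (subst minus_mult_distrib_mat_vec[of _ n n]) (auto intro!: eq_vecI)
  ultimately have "(A *\<^sub>v w - l \<cdot>\<^sub>v w) \<bullet>c y = 0"
    using A w yc by (subst comm_scalar_prod[of _ n]) auto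
  moreover have "(A *\<^sub>v w - l \<cdot>\<^sub>v w) \<bullet>c y = (A *\<^sub>v w) \<bullet>c y - (l \<cdot>\<^sub>v w) \<bullet>c y"
    using A w yc by (intro minus_scalar_prod_distrib[of _ n]) auto
  ultimately show ?thesis using w yc by simp
qed

text \<open>
  If the spectrum of \<open>A + tB\<close> stays in the disc of radius \<open>\<bar>l\<bar>\<close>, the derivative \<open>y\<^sup>*Bx / (y\<^sup>*x)\<close> of the
  simple eigenvalue \<open>l\<close> does not point out of the disc. No differentiable branch of eigenvalues has to
  be constructed: the determinant of \<open>\<mu> - A - tB\<close> at \<open>\<mu> = l\<close> and at the point \<open>\<mu> = l + kte\<close>
  outside the disc is compared. After division by \<open>t\<close> both converge as \<open>t\<close> tends to 0, and up to the
  same nonzero factor the limits are \<open>-y\<^sup>*Bx\<close> and \<open>k e y\<^sup>*x - y\<^sup>*Bx\<close>. By \<open>cmod_det_mono_outside\<close> the second is at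
  least as large in modulus for every \<open>k > 0\<close>, which for small \<open>k\<close> forces the sign.
\<close>

lemma Re_first_order_nonpos:
  fixes A B :: "complex mat"
  assumes A: "A \<in> carrier_mat n n" and B: "B \<in> carrier_mat n n"
    and x: "eigenvector A x l" and y: "left_eigenvector A y l"
    and simple: "order l (char_poly A) = 1"
    and l: "l = of_real r * e" and e: "cmod e = 1"
    and pos: "0 < e * (x \<bullet>c y)"
    and bound: "\<And>t a. 0 \<le> t \<Longrightarrow> t \<le> 1 \<Longrightarrow> eigenvalue (A + of_real t \<cdot>\<^sub>m B) a \<Longrightarrow> cmod a \<le> r"
  shows "Re ((B *\<^sub>v x) \<bullet>c y) \<le> 0"
proof -
  have xc: "x \<in> carrier_vec n" and Ax: "A *\<^sub>v x = l \<cdot>\<^sub>v x"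
    using x A by (auto simp: eigenvector_def)
  have yc: "y \<in> carrier_vec n" using y A by (simp add: left_eigenvector_def)
  obtain P where P: "P \<noteq> 0" and adjP: "adj_mat (l \<cdot>\<^sub>m 1\<^sub>m n - A) *\<^sub>v x = P \<cdot>\<^sub>v x"
    using adj_mat_simple_eigenvector[OF A xc Ax simple] .
  define X where "X k t = (l + of_real (k * t) * e) \<cdot>\<^sub>m 1\<^sub>m n - (A + of_real t \<cdot>\<^sub>m B)" for k t :: real
  define w where "w k t = adj_mat (X k t) *\<^sub>v x" for k t
  \<comment> \<open>For a fixed vector, \<open>y\<^sup>* X v\<close> is exactly linear in \<open>t\<close> with slope \<open>g k v\<close>, as \<open>y\<close> is a left eigenvector.\<close>
  define g where "g k v = of_real k * e * (v \<bullet>c y) - (B *\<^sub>v v) \<bullet>c y" for k :: real and v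
  have X: "X k t \<in> carrier_mat n n" for k t using A B by (auto simp: X_def)
  have adj: "adj_mat (X k t) \<in> carrier_mat n n" for k t by (rule adj_mat(1)[OF X])
  have wc: "w k t \<in> carrier_vec n" for k t using adj[of k t] xc by (auto simp: w_def)
  have Xv: "(X k t *\<^sub>v v) \<bullet>c y = of_real t * g k v" if v: "v \<in> carrier_vec n" for k t v
  proof -
    have "X k t *\<^sub>v v = (l + of_real (k * t) * e) \<cdot>\<^sub>v v - (A *\<^sub>v v + of_real t \<cdot>\<^sub>v (B *\<^sub>v v))"
      unfolding X_def using A B v
      by (subst minus_mult_distrib_mat_vec[of _ n n])
         (auto simp: add_mult_distrib_mat_vec[of _ n n] intro!: eq_vecI)
    then have "(X k t *\<^sub>v v) \<bullet>c y
        = (l + of_real (k * t) * e) * (v \<bullet>c y) - ((A *\<^sub>v v) \<bullet>c y + of_real t * ((B *\<^sub>v v) \<bullet>c y))"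
      using A B v yc
      by (simp add: minus_scalar_prod_distrib[of _ n] add_scalar_prod_distrib[of _ n])
    also have "\<dots> = of_real t * g k v"
      unfolding left_eigenvector_inner[OF A y v] g_def by (simp add: algebra_simps)
    finally show ?thesis .
  qed
  \<comment> \<open>Only \<open>w k t\<close> depends on \<open>t\<close> nonlinearly, and it tends to \<open>P x\<close>.\<close>
  have detX: "det (X k t) * (x \<bullet>c y) = of_real t * g k (w k t)" for k t
  proof -
    have "X k t *\<^sub>v w k t = det (X k t) \<cdot>\<^sub>v x"
      unfolding w_def assoc_mult_mat_vec[OF X adj xc, symmetric] adj_mat(2)[OF X]
      using xc by (auto intro!: eq_vecI)
    then show ?thesis using Xv[OF wc] xc yc by (metis carrier_vec_conjugate smult_scalar_prod_distrib)
  qed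
  have le: "cmod (g 0 (w 0 t)) \<le> cmod (g k (w k t))" if "0 < t" "t \<le> 1" "0 \<le> k" for k t
  proof -
    have "cmod (det (X 0 t)) \<le> cmod (det (X k t))"
      using cmod_det_mono_outside[of "A + of_real t \<cdot>\<^sub>m B" n e "k * t" r] A B e that bound[of t]
      by (simp add: X_def l)
    then have "cmod (det (X 0 t) * (x \<bullet>c y)) \<le> cmod (det (X k t) * (x \<bullet>c y))"
      by (simp add: norm_mult mult_right_mono)
    then show ?thesis unfolding detX using that by (simp add: norm_mult)
  qed
  have wlim: "((\<lambda>t. w k t $ i) \<longlongrightarrow> P * x $ i) (at_right 0)" if i: "i < n" for k i
  proof -
    have "w k t $ i = (\<Sum>j<n. adj_mat (X k t) $$ (i, j) * x $ j)" for t
      using adj[of k t] i xc by (auto simp: w_def scalar_prod_def atLeast0LessThan intro!: sum.cong)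
    moreover have "((\<lambda>t. \<Sum>j<n. adj_mat (X k t) $$ (i, j) * x $ j)
        \<longlongrightarrow> (\<Sum>j<n. adj_mat (X k 0) $$ (i, j) * x $ j)) (at_right 0)"
      by (intro tendsto_sum tendsto_mult tendsto_const tendsto_adj_mat[OF X X])
         (use A B i in \<open>auto simp: X_def intro!: tendsto_eq_intros\<close>)
    moreover have "X k 0 = l \<cdot>\<^sub>m 1\<^sub>m n - A" using A B by (intro eq_matI) (auto simp: X_def)
    then have "(\<Sum>j<n. adj_mat (X k 0) $$ (i, j) * x $ j) = P * x $ i"
      using arg_cong[OF adjP, of "\<lambda>v. v $ i"] adj[of k 0] i xc
      by (auto simp: scalar_prod_def atLeast0LessThan)
    ultimately show ?thesis by simp
  qed
  have glim: "((\<lambda>t. g k (w k t)) \<longlongrightarrow> P * g k x) (at_right 0)" for k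
  proof -
    have g: "g k v = of_real k * e * (\<Sum>i<n. v $ i * cnj (y $ i))
          - (\<Sum>i<n. (\<Sum>j<n. B $$ (i, j) * v $ j) * cnj (y $ i))" if "v \<in> carrier_vec n" for v
      using that yc B by (auto simp: g_def scalar_prod_def atLeast0LessThan)
    have "((\<lambda>t. g k (w k t)) \<longlongrightarrow> g k (P \<cdot>\<^sub>v x)) (at_right 0)"
      unfolding g[OF wc] g[OF smult_carrier_vec[THEN iffD2, OF xc]]
      using xc by (intro tendsto_intros) (auto intro!: tendsto_eq_intros wlim)
    moreover have "g k (P \<cdot>\<^sub>v x) = P * g k x"
      using xc yc B by (simp add: g_def mult_mat_vec[of _ n n] algebra_simps)
    ultimately show ?thesis by simp
  qed
  define b where "b = (B *\<^sub>v x) \<bullet>c y"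
  obtain c where c: "e * (x \<bullet>c y) = of_real c" "0 < c"
    using pos by (intro that[of "Re (e * (x \<bullet>c y))"])
      (auto simp: less_complex_def complex_eq_iff simp del: times_complex.sel)
  have half: "Re b \<le> k * c / 2" if k: "0 < k" for k
  proof -
    have "cmod (P * g 0 x) \<le> cmod (P * g k x)"
    proof (rule tendsto_le[OF _ tendsto_norm[OF glim] tendsto_norm[OF glim]])
      show "\<forall>\<^sub>F t in at_right 0. cmod (g 0 (w 0 t)) \<le> cmod (g k (w k t))"
        using k by (auto simp: eventually_at_right_field intro!: exI[of _ 1] le)
    qed simp
    then have "cmod b \<le> cmod (of_real (k * c) - b)"
      using P by (simp add: norm_mult g_def b_def mult.assoc c)
    then have "(cmod b)\<^sup>2 \<le> (cmod (of_real (k * c) - b))\<^sup>2" by simp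
    then have "0 \<le> (k * c) * (k * c - 2 * Re b)"
      unfolding cmod_power2 by (simp add: power2_eq_square algebra_simps)
    moreover have "0 < k * c" using k c by simp
    ultimately show ?thesis by (simp add: zero_le_mult_iff)
  qed
  show ?thesis
  proof (rule ccontr)
    assume "\<not> ?thesis"
    then have "0 < Re b" by (simp add: b_def)
    with half[of "Re b / c"] c show False by simp
  qed
qed

section \<open>Euclidean norm, adjoint and contractions\<close>

lemma vnorm_L2: "vnorm v = L2_set (\<lambda>i. cmod (v $ i)) {..<dim_vec v}"
  by (simp add: vnorm_def L2_set_def)

lemma vnorm_nonneg [simp]: "0 \<le> vnorm v"
  by (simp add: vnorm_L2)

lemma vnorm_inner: "of_real ((vnorm v)\<^sup>2) = v \<bullet>c v"
  by (simp add: vnorm_def sum_nonneg scalar_prod_def atLeast0LessThan complex_norm_square del: of_real_power)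

lemma vnorm_smult: "vnorm (c \<cdot>\<^sub>v v) = cmod c * vnorm v"
  by (auto simp: vnorm_L2 norm_mult L2_set_right_distrib intro!: L2_set_cong)

lemma vnorm_triangle:
  assumes "v \<in> carrier_vec n" "w \<in> carrier_vec n"
  shows "vnorm (v + w) \<le> vnorm v + vnorm w"
proof -
  have "vnorm (v + w) \<le> L2_set (\<lambda>i. cmod (v $ i) + cmod (w $ i)) {..<n}"
    using assms by (auto simp: vnorm_L2 intro!: L2_set_mono norm_triangle_ineq)
  also have "\<dots> \<le> vnorm v + vnorm w"
    using assms L2_set_triangle_ineq[of "\<lambda>i. cmod (v $ i)" "\<lambda>i. cmod (w $ i)" "{..<n}"]
    by (auto simp: vnorm_L2)
  finally show ?thesis .
qed

lemma cmod_inner_le: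
  assumes "v \<in> carrier_vec n" "w \<in> carrier_vec n"
  shows "cmod (v \<bullet>c w) \<le> vnorm v * vnorm w"
proof -
  have "cmod (v \<bullet>c w) \<le> (\<Sum>i<n. cmod (v $ i) * cmod (w $ i))"
    using assms norm_sum[of "\<lambda>i. v $ i * cnj (w $ i)" "{..<n}"]
    by (simp add: scalar_prod_def atLeast0LessThan norm_mult)
  also have "\<dots> \<le> vnorm v * vnorm w"
    using assms L2_set_mult_ineq[of "\<lambda>i. cmod (v $ i)" "\<lambda>i. cmod (w $ i)" "{..<n}"]
    by (auto simp: vnorm_L2)
  finally show ?thesis .
qed

lemma vnorm_eq_0_iff:
  assumes "v \<in> carrier_vec n"
  shows "vnorm v = 0 \<longleftrightarrow> v = 0\<^sub>v n"
  using assms by (auto simp: vnorm_L2 L2_set_eq_0_iff intro!: eq_vecI)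

lemma vnorm_diff_sq:
  assumes v: "v \<in> carrier_vec n" and w: "w \<in> carrier_vec n"
  shows "(vnorm (v - w))\<^sup>2 = (vnorm v)\<^sup>2 + (vnorm w)\<^sup>2 - 2 * Re (v \<bullet>c w)"
proof -
  have "(vnorm (v - w))\<^sup>2 = (\<Sum>i<n. (cmod (v $ i - w $ i))\<^sup>2)"
    using v w by (simp add: vnorm_def sum_nonneg)
  also have "\<dots> = (\<Sum>i<n. (cmod (v $ i))\<^sup>2 + (cmod (w $ i))\<^sup>2 - 2 * Re (v $ i * cnj (w $ i)))"
    by (intro sum.cong refl) (simp only: cmod_power2, simp add: power2_eq_square algebra_simps)
  also have "\<dots> = (\<Sum>i<n. (cmod (v $ i))\<^sup>2) + (\<Sum>i<n. (cmod (w $ i))\<^sup>2)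
      - 2 * (\<Sum>i<n. Re (v $ i * cnj (w $ i)))"
    by (simp only: sum_subtractf sum.distrib sum_distrib_left)
  also have "(\<Sum>i<n. Re (v $ i * cnj (w $ i))) = Re (v \<bullet>c w)"
    using v w by (simp add: scalar_prod_def atLeast0LessThan del: times_complex.sel)
  also have "(\<Sum>i<n. (cmod (v $ i))\<^sup>2) = (vnorm v)\<^sup>2"
    using v by (simp add: vnorm_def sum_nonneg)
  also have "(\<Sum>i<n. (cmod (w $ i))\<^sup>2) = (vnorm w)\<^sup>2"
    using w by (simp add: vnorm_def sum_nonneg)
  finally show ?thesis .
qed

lemma vnorm_append: "(vnorm (v @\<^sub>v w))\<^sup>2 = (vnorm v)\<^sup>2 + (vnorm w)\<^sup>2"
proof -
  have "conjugate (v @\<^sub>v w) = conjugate v @\<^sub>v conjugate w" by (intro eq_vecI) auto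
  then have "(v @\<^sub>v w) \<bullet>c (v @\<^sub>v w) = v \<bullet>c v + w \<bullet>c w"
    by (simp only:) (rule scalar_prod_append; rule carrier_vecI; simp)
  then have "complex_of_real ((vnorm (v @\<^sub>v w))\<^sup>2) = of_real ((vnorm v)\<^sup>2 + (vnorm w)\<^sup>2)"
    unfolding of_real_add vnorm_inner .
  then show ?thesis by (simp only: of_real_eq_iff)
qed

lemma mat_adjoint_carrier:
  "A \<in> carrier_mat n m \<Longrightarrow> mat_adjoint A \<in> carrier_mat m n"
  by (auto simp: mat_adjoint_def mat_of_rows_def)

lemma mat_adjoint_index:
  fixes A :: "complex mat"
  assumes "A \<in> carrier_mat n m" "i < m" "j < n"
  shows "mat_adjoint A $$ (i, j) = cnj (A $$ (j, i))"
  using assms by (auto simp: mat_adjoint_def mat_of_rows_def cols_def)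

lemma inner_mat_adjoint:
  fixes A :: "complex mat"
  assumes A: "A \<in> carrier_mat n m" and v: "v \<in> carrier_vec m" and w: "w \<in> carrier_vec n"
  shows "(A *\<^sub>v v) \<bullet>c w = v \<bullet>c (mat_adjoint A *\<^sub>v w)"
proof -
  have "(A *\<^sub>v v) \<bullet>c w = (\<Sum>i<n. \<Sum>j<m. A $$ (i, j) * v $ j * cnj (w $ i))"
    using A v w by (auto simp: scalar_prod_def atLeast0LessThan sum_distrib_right intro!: sum.cong)
  also have "\<dots> = (\<Sum>j<m. \<Sum>i<n. A $$ (i, j) * v $ j * cnj (w $ i))" by (rule sum.swap)
  also have "\<dots> = v \<bullet>c (mat_adjoint A *\<^sub>v w)"
    using A v w mat_adjoint_carrier[OF A]
    by (auto simp: scalar_prod_def atLeast0LessThan sum_distrib_left mat_adjoint_index[OF A]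
        mult_ac intro!: sum.cong)
  finally show ?thesis .
qed

text \<open>
  Working with the pointwise inequality avoids the supremum; by \<open>spec_norm_le_1_iff\<close> below it
  describes the unit ball of the spectral norm.
\<close>

definition contraction :: "complex mat \<Rightarrow> bool" where
  "contraction A \<longleftrightarrow> (\<forall>v\<in>carrier_vec (dim_col A). vnorm (A *\<^sub>v v) \<le> vnorm v)"

lemma contractionD:
  "contraction A \<Longrightarrow> A \<in> carrier_mat n m \<Longrightarrow> v \<in> carrier_vec m \<Longrightarrow> vnorm (A *\<^sub>v v) \<le> vnorm v"
  by (auto simp: contraction_def)

text \<open>
  Without this bound the supremum that defines \<open>spec_norm\<close> would be an unspecified real number.
\<close>

lemma vnorm_mult_mat_vec_bounded:
  "\<exists>c. \<forall>v\<in>carrier_vec (dim_col A). vnorm (A *\<^sub>v v) \<le> c * vnorm v"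
proof (intro exI ballI)
  fix v :: "complex vec" assume v: "v \<in> carrier_vec (dim_col A)"
  have row: "cmod ((A *\<^sub>v v) $ i) \<le> vnorm (row A i) * vnorm v" if "i < dim_row A" for i
  proof -
    have "vnorm (conjugate v) = vnorm v"  by (auto simp: vnorm_L2 intro!: L2_set_cong)
    then show ?thesis
      using cmod_inner_le[of "row A i" "dim_col A" "conjugate v"] that v by simp
  qed
  have "vnorm (A *\<^sub>v v) \<le> L2_set (\<lambda>i. vnorm (row A i) * vnorm v) {..<dim_row A}"
    unfolding vnorm_L2[of "A *\<^sub>v v"] using row by (auto intro!: L2_set_mono)
  then show "vnorm (A *\<^sub>v v) \<le> L2_set (\<lambda>i. vnorm (row A i)) {..<dim_row A} * vnorm v"
    by (simp add: L2_set_left_distrib)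
qed

lemma spec_norm_le_1_iff: "spec_norm A \<le> 1 \<longleftrightarrow> contraction A"
proof
  let ?S = "{v \<in> carrier_vec (dim_col A). vnorm v \<le> 1}"
  have ne: "?S \<noteq> {}" by (auto intro!: exI[of _ "0\<^sub>v (dim_col A)"] simp: vnorm_def)
  {
    assume le: "spec_norm A \<le> 1"
    obtain c where c: "\<And>v. v \<in> carrier_vec (dim_col A) \<Longrightarrow> vnorm (A *\<^sub>v v) \<le> c * vnorm v"
      using vnorm_mult_mat_vec_bounded[of A] by blast
    have bdd: "bdd_above ((\<lambda>v. vnorm (A *\<^sub>v v)) ` ?S)"
    proof (rule bdd_aboveI2)
      fix v assume v: "v \<in> ?S"
      then have "vnorm (A *\<^sub>v v) \<le> c * vnorm v" using c by simp
      also have "\<dots> \<le> \<bar>c\<bar> * 1" using v by (intro mult_mono) auto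
      finally show "vnorm (A *\<^sub>v v) \<le> \<bar>c\<bar>" by simp
    qed
    show "contraction A" unfolding contraction_def
    proof
      fix v :: "complex vec" assume v: "v \<in> carrier_vec (dim_col A)"
      show "vnorm (A *\<^sub>v v) \<le> vnorm v"
      proof (cases "vnorm v = 0")
        case True then show ?thesis using c[OF v] by simp
      next
        case False
        let ?w = "complex_of_real (1 / vnorm v) \<cdot>\<^sub>v v"
        have "?w \<in> ?S" using v False by (simp add: vnorm_smult norm_divide)
        then have "vnorm (A *\<^sub>v ?w) \<le> spec_norm A"
          unfolding spec_norm_def by (rule cSUP_upper[OF _ bdd])
        also have "A *\<^sub>v ?w = complex_of_real (1 / vnorm v) \<cdot>\<^sub>v (A *\<^sub>v v)"
          using v by (intro mult_mat_vec[of _ "dim_row A" "dim_col A"]) auto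
        finally show ?thesis
          using False vnorm_nonneg[of v] order_trans[OF _ mult_right_mono[OF le vnorm_nonneg[of v]]]
          by (simp add: vnorm_smult norm_divide divide_le_eq)
      qed
    qed
  }
  assume "contraction A"
  then show "spec_norm A \<le> 1"
    unfolding spec_norm_def contraction_def using ne by (intro cSUP_least) fastforce+
qed

lemma contraction_convex:
  assumes A: "contraction A" "A \<in> carrier_mat n m" and B: "contraction B" "B \<in> carrier_mat n m"
    and ab: "cmod a + cmod b \<le> 1"
  shows "contraction (a \<cdot>\<^sub>m A + b \<cdot>\<^sub>m B)"
  unfolding contraction_def
proof
  fix v :: "complex vec" assume "v \<in> carrier_vec (dim_col (a \<cdot>\<^sub>m A + b \<cdot>\<^sub>m B))"
  then have v: "v \<in> carrier_vec m" using B by simp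
  have "(a \<cdot>\<^sub>m A + b \<cdot>\<^sub>m B) *\<^sub>v v = a \<cdot>\<^sub>v (A *\<^sub>v v) + b \<cdot>\<^sub>v (B *\<^sub>v v)"
    using A B v by (auto simp: add_mult_distrib_mat_vec[of _ n m] intro!: eq_vecI)
  then have "vnorm ((a \<cdot>\<^sub>m A + b \<cdot>\<^sub>m B) *\<^sub>v v) \<le> cmod a * vnorm (A *\<^sub>v v) + cmod b * vnorm (B *\<^sub>v v)"
    using vnorm_triangle[of "a \<cdot>\<^sub>v (A *\<^sub>v v)" n "b \<cdot>\<^sub>v (B *\<^sub>v v)"] A B v by (simp add: vnorm_smult)
  also have "\<dots> \<le> cmod a * vnorm v + cmod b * vnorm v"
    using contractionD[OF A v] contractionD[OF B v] by (intro add_mono mult_left_mono) auto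
  also have "\<dots> \<le> vnorm v"
    using ab mult_right_mono[OF ab vnorm_nonneg[of v]] by (simp add: distrib_right)
  finally show "vnorm ((a \<cdot>\<^sub>m A + b \<cdot>\<^sub>m B) *\<^sub>v v) \<le> vnorm v" .
qed

lemma outer_mult_vec:
  assumes "v \<in> carrier_vec m" "w \<in> carrier_vec m"
  shows "outer u v *\<^sub>v w = (w \<bullet>c v) \<cdot>\<^sub>v u"
  using assms by (intro eq_vecI)
    (auto simp: outer_def scalar_prod_def atLeast0LessThan sum_distrib_left mult_ac intro!: sum.cong)

lemma contraction_outer:
  assumes "vnorm u = 1" "vnorm v = 1"
  shows "contraction (outer u v)"
  unfolding contraction_def
proof
  fix w :: "complex vec" assume "w \<in> carrier_vec (dim_col (outer u v))"
  then have w: "w \<in> carrier_vec (dim_vec v)" by (simp add: outer_def)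
  have v: "v \<in> carrier_vec (dim_vec v)" by (rule carrier_vecI) simp
  show "vnorm (outer u v *\<^sub>v w) \<le> vnorm w"
    using cmod_inner_le[OF w v] assms by (simp add: outer_mult_vec[OF v w] vnorm_smult)
qed

text \<open>
  The equality case of Cauchy-Schwarz: \<open>\<parallel>Av - u\<parallel>\<^sup>2\<close> and \<open>\<parallel>v - A\<^sup>*u\<parallel>\<^sup>2\<close> both expand to at most
  \<open>2 - 2 Re u\<^sup>*Av \<le> 0\<close>. The second expansion needs \<open>\<parallel>A\<^sup>*u\<parallel> \<le> 1\<close>, obtained from
  \<open>\<parallel>A\<^sup>*u\<parallel>\<^sup>2 = Re u\<^sup>*AA\<^sup>*u\<close> and the contractivity of \<open>A\<close>.
\<close>

lemma singular_vectors_1I: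
  assumes A: "A \<in> carrier_mat n m" and contr: "contraction A"
    and u: "u \<in> carrier_vec n" "vnorm u = 1" and v: "v \<in> carrier_vec m" "vnorm v = 1"
    and ge: "1 \<le> Re ((A *\<^sub>v v) \<bullet>c u)"
  shows "singular_vectors_1 A u v"
proof -
  let ?B = "mat_adjoint A"
  have B: "?B \<in> carrier_mat m n" by (rule mat_adjoint_carrier[OF A])
  have Av: "A *\<^sub>v v \<in> carrier_vec n" and Bu: "?B *\<^sub>v u \<in> carrier_vec m" using A B u v by auto
  have eqI: "a = b" if "a \<in> carrier_vec k" "b \<in> carrier_vec k" "(vnorm (a - b))\<^sup>2 \<le> 0" for a b k
  proof -
    have "a - b = 0\<^sub>v k" using that vnorm_eq_0_iff[of "a - b" k] by simp
    then have "(a - b) $ i = 0" if "i < k" for i using that by simp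
    then show ?thesis using that by (intro eq_vecI) auto
  qed
  have sq: "(vnorm (A *\<^sub>v w))\<^sup>2 \<le> (vnorm w)\<^sup>2" if "w \<in> carrier_vec m" for w
    using contractionD[OF contr A that] by simp
  have "A *\<^sub>v v = u"
    using vnorm_diff_sq[OF Av u(1)] sq[OF v(1)] ge u v by (intro eqI[OF Av u(1)]) simp
  moreover have "(vnorm (?B *\<^sub>v u))\<^sup>2 \<le> 1"
  proof -
    have "A *\<^sub>v (?B *\<^sub>v u) \<in> carrier_vec n" using A B u by auto
    from vnorm_diff_sq[OF this u(1)]
    have "2 * Re ((A *\<^sub>v (?B *\<^sub>v u)) \<bullet>c u) \<le> (vnorm (?B *\<^sub>v u))\<^sup>2 + 1"
      using sq[OF Bu] u(2) zero_le_power2[of "vnorm (A *\<^sub>v (?B *\<^sub>v u) - u)"]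
      unfolding u(2) one_power2 by linarith
    moreover have "(A *\<^sub>v (?B *\<^sub>v u)) \<bullet>c u = of_real ((vnorm (?B *\<^sub>v u))\<^sup>2)"
      unfolding inner_mat_adjoint[OF A Bu u(1)] vnorm_inner ..
    ultimately show ?thesis by simp
  qed
  then have "v = ?B *\<^sub>v u"
    using vnorm_diff_sq[OF v(1) Bu] inner_mat_adjoint[OF A v(1) u(1)] ge v
    by (intro eqI[OF v(1) Bu]) simp
  ultimately show ?thesis using A u v by (simp add: singular_vectors_1_def)
qed

section \<open>Block diagonal matrices\<close>

lemma diag_block_mat_carrier:
  assumes "list_all2 (\<lambda>A k. A \<in> carrier_mat k k) As ks"
  shows "diag_block_mat As \<in> carrier_mat (sum_list ks) (sum_list ks)"
  using assms
  by (induction rule: list_all2_induct) (auto simp: Let_def)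

lemma diag_block_mat_Cons:
  assumes "A \<in> carrier_mat k k" "list_all2 (\<lambda>A k. A \<in> carrier_mat k k) As ks"
  shows "diag_block_mat (A # As)
    = four_block_mat A (0\<^sub>m k (sum_list ks)) (0\<^sub>m (sum_list ks) k) (diag_block_mat As)"
  using assms(1) diag_block_mat_carrier[OF assms(2)] by (auto simp: Let_def)

lemma diag_block_mat_lincomb:
  assumes "list_all2 (\<lambda>A k. A \<in> carrier_mat k k) As ks"
    and "list_all2 (\<lambda>A k. A \<in> carrier_mat k k) Bs ks"
  shows "diag_block_mat (map2 (\<lambda>A B. a \<cdot>\<^sub>m A + b \<cdot>\<^sub>m B) As Bs)
       = (a :: complex) \<cdot>\<^sub>m diag_block_mat As + b \<cdot>\<^sub>m diag_block_mat Bs"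
  using assms
proof (induction As ks arbitrary: Bs rule: list_all2_induct)
  case Nil
  then show ?case by auto
next
  case (Cons A As k ks)
  from Cons.prems obtain B Bs' where Bs: "Bs = B # Bs'" and B: "B \<in> carrier_mat k k"
    and Bs': "list_all2 (\<lambda>A k. A \<in> carrier_mat k k) Bs' ks"
    by (auto simp: list_all2_Cons2)
  note car = diag_block_mat_carrier[OF Cons.hyps(2)] diag_block_mat_carrier[OF Bs']
  have "list_all2 (\<lambda>A k. A \<in> carrier_mat k k) (map2 (\<lambda>A B. a \<cdot>\<^sub>m A + b \<cdot>\<^sub>m B) As Bs') ks"
    using Cons.hyps(2) Bs' by (auto simp: list_all2_conv_all_nth)
  from diag_block_mat_Cons[OF _ this, of "a \<cdot>\<^sub>m A + b \<cdot>\<^sub>m B" k]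
  have "diag_block_mat (map2 (\<lambda>A B. a \<cdot>\<^sub>m A + b \<cdot>\<^sub>m B) (A # As) Bs)
    = four_block_mat (a \<cdot>\<^sub>m A + b \<cdot>\<^sub>m B) (0\<^sub>m k (sum_list ks)) (0\<^sub>m (sum_list ks) k)
        (a \<cdot>\<^sub>m diag_block_mat As + b \<cdot>\<^sub>m diag_block_mat Bs')"
    using Cons.hyps(1) B Cons.IH[OF Bs'] by (simp add: Bs)
  also have "\<dots> = a \<cdot>\<^sub>m diag_block_mat (A # As) + b \<cdot>\<^sub>m diag_block_mat Bs"
    unfolding Bs diag_block_mat_Cons[OF Cons.hyps(1,2)] diag_block_mat_Cons[OF B Bs']
    using Cons.hyps(1) B car by (intro eq_matI) auto
  finally show ?case .
qed

text \<open>
  Vectors padded with zeros isolate a single block; conversely the squared norms of the pieces add up.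
\<close>

lemma contraction_diag_block_mat:
  assumes "list_all2 (\<lambda>A k. A \<in> carrier_mat k k) As ks"
  shows "contraction (diag_block_mat As) \<longleftrightarrow> (\<forall>A\<in>set As. contraction A)"
  using assms
proof (induction rule: list_all2_induct)
  case Nil
  then show ?case by (auto simp: contraction_def vnorm_def)
next
  case (Cons A As k ks)
  let ?D = "diag_block_mat As" and ?n = "sum_list ks"
  note A = Cons.hyps(1)
  note D = diag_block_mat_carrier[OF Cons.hyps(2)]
  have E: "diag_block_mat (A # As) \<in> carrier_mat (k + ?n) (k + ?n)"
    using diag_block_mat_carrier[of "A # As" "k # ks"] Cons.hyps by simp
  have split: "diag_block_mat (A # As) *\<^sub>v (v @\<^sub>v w) = (A *\<^sub>v v) @\<^sub>v (?D *\<^sub>v w)"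
    if "v \<in> carrier_vec k" "w \<in> carrier_vec ?n" for v w
    unfolding diag_block_mat_Cons[OF A Cons.hyps(2)] by (rule mult_mat_vec_split[OF A D that])
  have zero: "vnorm (0\<^sub>v m) = 0" for m by (simp add: vnorm_def)
  have iff: "contraction (diag_block_mat (A # As)) \<longleftrightarrow> contraction A \<and> contraction ?D"
  proof (intro iffI conjI)
    assume c: "contraction (diag_block_mat (A # As))"
    show "contraction A" unfolding contraction_def
    proof
      fix v :: "complex vec" assume "v \<in> carrier_vec (dim_col A)"
      then have v: "v \<in> carrier_vec k" using A by simp
      have "v @\<^sub>v 0\<^sub>v ?n \<in> carrier_vec (k + ?n)" using v by simp
      from contractionD[OF c E this]
      have "(vnorm ((A *\<^sub>v v) @\<^sub>v (?D *\<^sub>v 0\<^sub>v ?n)))\<^sup>2 \<le> (vnorm (v @\<^sub>v 0\<^sub>v ?n))\<^sup>2"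
        using split[OF v] by (intro power_mono) auto
      then have "(vnorm (A *\<^sub>v v))\<^sup>2 + (vnorm (?D *\<^sub>v 0\<^sub>v ?n))\<^sup>2 \<le> (vnorm v)\<^sup>2"
        by (simp add: vnorm_append zero)
      then have "(vnorm (A *\<^sub>v v))\<^sup>2 \<le> (vnorm v)\<^sup>2"
        by (rule order_trans[rotated]) simp
      then show "vnorm (A *\<^sub>v v) \<le> vnorm v" by simp
    qed
    show "contraction ?D" unfolding contraction_def
    proof
      fix v :: "complex vec" assume "v \<in> carrier_vec (dim_col ?D)"
      then have v: "v \<in> carrier_vec ?n" using D by simp
      have "0\<^sub>v k @\<^sub>v v \<in> carrier_vec (k + ?n)" using v by simp
      from contractionD[OF c E this]
      have "(vnorm ((A *\<^sub>v 0\<^sub>v k) @\<^sub>v (?D *\<^sub>v v)))\<^sup>2 \<le> (vnorm (0\<^sub>v k @\<^sub>v v))\<^sup>2"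
        using split[OF _ v] by (intro power_mono) auto
      then have "(vnorm (A *\<^sub>v 0\<^sub>v k))\<^sup>2 + (vnorm (?D *\<^sub>v v))\<^sup>2 \<le> (vnorm v)\<^sup>2"
        by (simp add: vnorm_append zero)
      then have "(vnorm (?D *\<^sub>v v))\<^sup>2 \<le> (vnorm v)\<^sup>2"
        by (rule order_trans[rotated]) simp
      then show "vnorm (?D *\<^sub>v v) \<le> vnorm v" by simp
    qed
  next
    assume c: "contraction A \<and> contraction ?D"
    show "contraction (diag_block_mat (A # As))" unfolding contraction_def
    proof
      fix x :: "complex vec" assume "x \<in> carrier_vec (dim_col (diag_block_mat (A # As)))"
      then have "x \<in> carrier_vec (k + ?n)" using E by simp
      then obtain v w where x: "x = v @\<^sub>v w" and v: "v \<in> carrier_vec k" and w: "w \<in> carrier_vec ?n"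
        by (metis vec_first_last_append vec_first_carrier vec_last_carrier)
      have "(vnorm (diag_block_mat (A # As) *\<^sub>v x))\<^sup>2 \<le> (vnorm x)\<^sup>2"
        unfolding x split[OF v w] vnorm_append
        using contractionD[OF _ A v] contractionD[OF _ D w] c
        by (intro add_mono power_mono) auto
      then show "vnorm (diag_block_mat (A # As) *\<^sub>v x) \<le> vnorm x" by simp
    qed
  qed
  then show ?case using Cons.IH by simp
qed

lemma vec_block_carrier [simp]: "vec_block ks x k \<in> carrier_vec (ks ! k)"
  by (simp add: vec_block_def)

lemma vec_block_append:
  assumes "v \<in> carrier_vec k" "w \<in> carrier_vec (sum_list ks)"
  shows "vec_block (k # ks) (v @\<^sub>v w) 0 = v"
    and "i < length ks \<Longrightarrow> vec_block (k # ks) (v @\<^sub>v w) (Suc i) = vec_block ks w i"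
proof -
  show "vec_block (k # ks) (v @\<^sub>v w) 0 = v"
    using assms by (auto simp: vec_block_def)
  assume i: "i < length ks"
  have "sum_list (take i ks) + j < sum_list ks" if "j < ks ! i" for j
  proof -
    have "sum_list ks = sum_list (take i ks) + (ks ! i + sum_list (drop (Suc i) ks))"
      by (metis append_take_drop_id sum_list_append Cons_nth_drop_Suc[OF i] sum_list.Cons)
    then show ?thesis using that by simp
  qed
  then show "vec_block (k # ks) (v @\<^sub>v w) (Suc i) = vec_block ks w i"
    using assms by (auto simp: vec_block_def add.assoc intro!: eq_vecI)
qed

text \<open>
  The sesquilinear form of a block diagonal matrix decouples; this is what reduces the
  maximality of \<open>D\<close> to that of its individual blocks.
\<close>

lemma inner_diag_block_mat:
  fixes As :: "complex mat list"
  assumes "list_all2 (\<lambda>A k. A \<in> carrier_mat k k) As ks"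
    and "x \<in> carrier_vec (sum_list ks)" and "z \<in> carrier_vec (sum_list ks)"
  shows "(diag_block_mat As *\<^sub>v x) \<bullet>c z
       = (\<Sum>i<length ks. (As ! i *\<^sub>v vec_block ks x i) \<bullet>c vec_block ks z i)"
  using assms
proof (induction arbitrary: x z rule: list_all2_induct)
  case Nil
  then show ?case by (simp add: scalar_prod_def)
next
  case (Cons A As k ks)
  note A = Cons.hyps(1)
  note D = diag_block_mat_carrier[OF Cons.hyps(2)]
  from Cons.prems obtain x1 x2 where x: "x = x1 @\<^sub>v x2"
    and x1: "x1 \<in> carrier_vec k" and x2: "x2 \<in> carrier_vec (sum_list ks)"
    by (metis vec_first_last_append vec_first_carrier vec_last_carrier sum_list.Cons)
  from Cons.prems obtain z1 z2 where z: "z = z1 @\<^sub>v z2"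
    and z1: "z1 \<in> carrier_vec k" and z2: "z2 \<in> carrier_vec (sum_list ks)"
    by (metis vec_first_last_append vec_first_carrier vec_last_carrier sum_list.Cons)
  have cz: "conjugate (z1 @\<^sub>v z2) = conjugate z1 @\<^sub>v conjugate z2" by (intro eq_vecI) auto
  have "(diag_block_mat (A # As) *\<^sub>v x) \<bullet>c z = (A *\<^sub>v x1) \<bullet>c z1 + (diag_block_mat As *\<^sub>v x2) \<bullet>c z2"
    unfolding x z cz diag_block_mat_Cons[OF A Cons.hyps(2)] mult_mat_vec_split[OF A D x1 x2]
    using A D x1 x2 z1 z2 by (intro scalar_prod_append[of _ k _ "sum_list ks"]) auto
  also have "\<dots> = (\<Sum>i<length (k # ks). ((A # As) ! i *\<^sub>v vec_block (k # ks) x i) \<bullet>c vec_block (k # ks) z i)"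
    unfolding Cons.IH[OF x2 z2] x z using vec_block_append[OF x1 x2] vec_block_append[OF z1 z2]
    by (simp add: sum.lessThan_Suc_shift del: sum.lessThan_Suc)
  finally show ?case .
qed

text \<open>
  The difference of the two products is orthogonal to every vector, itself included.
\<close>

lemma diag_block_mat_mult_vec_cong:
  fixes As Bs :: "complex mat list"
  assumes As: "list_all2 (\<lambda>A k. A \<in> carrier_mat k k) As ks"
    and Bs: "list_all2 (\<lambda>A k. A \<in> carrier_mat k k) Bs ks"
    and x: "x \<in> carrier_vec (sum_list ks)"
    and eq: "\<And>i. i < length ks \<Longrightarrow> As ! i *\<^sub>v vec_block ks x i = Bs ! i *\<^sub>v vec_block ks x i"
  shows "diag_block_mat As *\<^sub>v x = diag_block_mat Bs *\<^sub>v x"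
proof -
  let ?d = "diag_block_mat As *\<^sub>v x - diag_block_mat Bs *\<^sub>v x"
  note car = diag_block_mat_carrier[OF As] diag_block_mat_carrier[OF Bs]
  have d: "?d \<in> carrier_vec (sum_list ks)"
    using car by (intro carrier_vecI) simp
  have "?d \<bullet>c ?d = (diag_block_mat As *\<^sub>v x) \<bullet>c ?d - (diag_block_mat Bs *\<^sub>v x) \<bullet>c ?d"
    using car x d by (intro minus_scalar_prod_distrib[of _ "sum_list ks"]) auto
  also have "\<dots> = 0"
    unfolding inner_diag_block_mat[OF As x d] inner_diag_block_mat[OF Bs x d] using eq by simp
  finally have "?d = 0\<^sub>v (sum_list ks)" using d by simp
  then have "?d $ i = 0" if "i < sum_list ks" for i using that by simp
  then show ?thesis using car by (intro eq_vecI) auto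
qed

section \<open>The perturbation set and the value set\<close>

lemma list_all2_block_parts:
  assumes "block_parts rs ms ds Ds"
  shows "list_all2 (\<lambda>A k. A \<in> carrier_mat k k) (map2 (\<lambda>d r. d \<cdot>\<^sub>m 1\<^sub>m r) ds rs @ Ds) (rs @ ms)"
  using assms by (auto simp: block_parts_def list_all2_conv_all_nth nth_append)

lemma pert_set_carrier:
  "D \<in> pert_set rs ms \<Longrightarrow> D \<in> carrier_mat (sum_list rs + sum_list ms) (sum_list rs + sum_list ms)"
  using diag_block_mat_carrier[OF list_all2_block_parts]
  by (fastforce simp: pert_set_def block_pert_def)

lemma pert_set_lincomb:
  assumes "D \<in> pert_set rs ms" and "D' \<in> pert_set rs ms"
  shows "a \<cdot>\<^sub>m D + b \<cdot>\<^sub>m D' \<in> pert_set rs ms"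
proof -
  obtain ds Ds where D: "D = block_pert rs ds Ds" and parts: "block_parts rs ms ds Ds"
    using assms(1) by (auto simp: pert_set_def)
  obtain ds' Ds' where D': "D' = block_pert rs ds' Ds'" and parts': "block_parts rs ms ds' Ds'"
    using assms(2) by (auto simp: pert_set_def)
  let ?f = "\<lambda>A B. a \<cdot>\<^sub>m A + b \<cdot>\<^sub>m B"
  let ?ds = "map2 (\<lambda>d d'. a * d + b * d') ds ds'"
  have "map2 ?f (map2 (\<lambda>d r. d \<cdot>\<^sub>m 1\<^sub>m r) ds rs @ Ds) (map2 (\<lambda>d r. d \<cdot>\<^sub>m 1\<^sub>m r) ds' rs @ Ds')
      = map2 (\<lambda>d r. d \<cdot>\<^sub>m 1\<^sub>m r) ?ds rs @ map2 ?f Ds Ds'"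
    using parts parts'
    by (intro nth_equalityI) (auto simp: block_parts_def nth_append distrib_right intro!: eq_matI)
  then have "a \<cdot>\<^sub>m D + b \<cdot>\<^sub>m D' = block_pert rs ?ds (map2 ?f Ds Ds')"
    unfolding D D' block_pert_def
    using diag_block_mat_lincomb[OF list_all2_block_parts[OF parts] list_all2_block_parts[OF parts'], of a b]
    by (simp only:)
  moreover have "block_parts rs ms ?ds (map2 ?f Ds Ds')"
    using parts parts' by (auto simp: block_parts_def)
  ultimately show ?thesis unfolding pert_set_def by blast
qed

lemma scaled_prod_carrier [simp]:
  "M \<in> carrier_mat n n \<Longrightarrow> D \<in> carrier_mat n n \<Longrightarrow> scaled_prod e M D \<in> carrier_mat n n"
  by (auto simp: scaled_prod_def)

lemma smult_mat_mult_vec: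
  fixes A :: "complex mat"
  assumes "A \<in> carrier_mat n m" "v \<in> carrier_vec m"
  shows "(a \<cdot>\<^sub>m A) *\<^sub>v v = a \<cdot>\<^sub>v (A *\<^sub>v v)"
  using assms by (intro eq_vecI) auto

lemma scaled_prod_mult_vec:
  assumes "M \<in> carrier_mat n n" "D \<in> carrier_mat n n" "x \<in> carrier_vec n"
  shows "scaled_prod e M D *\<^sub>v x = of_real e \<cdot>\<^sub>v (M *\<^sub>v (D *\<^sub>v x))"
proof -
  have "scaled_prod e M D *\<^sub>v x = of_real e \<cdot>\<^sub>v ((M * D) *\<^sub>v x)"
    unfolding scaled_prod_def
    using smult_mat_mult_vec[OF mult_carrier_mat[OF assms(1,2)] assms(3)] .
  then show ?thesis using assoc_mult_mat_vec[OF assms] by simp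
qed

lemma scaled_prod_lincomb:
  assumes M: "M \<in> carrier_mat n n" and D: "D \<in> carrier_mat n n" and E: "E \<in> carrier_mat n n"
  shows "scaled_prod e M (a \<cdot>\<^sub>m D + b \<cdot>\<^sub>m E) = a \<cdot>\<^sub>m scaled_prod e M D + b \<cdot>\<^sub>m scaled_prod e M E"
proof -
  have "M * (a \<cdot>\<^sub>m D + b \<cdot>\<^sub>m E) = a \<cdot>\<^sub>m (M * D) + b \<cdot>\<^sub>m (M * E)"
    using mult_add_distrib_mat[OF M, of "a \<cdot>\<^sub>m D" n "b \<cdot>\<^sub>m E"] D E
    by (simp add: mult_smult_distrib[OF M D] mult_smult_distrib[OF M E])
  then show ?thesis
    unfolding scaled_prod_def using M D E by (auto intro!: eq_matI simp: algebra_simps)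
qed

lemma spectral_radius_eqI:
  assumes A: "A \<in> carrier_mat n n" and l: "eigenvalue A l"
    and bound: "\<And>a. eigenvalue A a \<Longrightarrow> cmod a \<le> cmod l"
  shows "spectral_radius A = cmod l"
  unfolding spectral_radius_def spectrum_def
  using card_finite_spectrum(1)[OF A] l bound
  by (intro Max_eqI) (auto simp: spectrum_def)

text \<open>
  Scaling the perturbation scales the eigenvalue, so the value set is a disc about the origin.
\<close>

lemma value_set_scale:
  assumes M: "M \<in> carrier_mat n n" and n: "n = sum_list rs + sum_list ms"
    and w: "w \<in> value_set rs ms e M" and c: "cmod c \<le> 1"
  shows "c * w \<in> value_set rs ms e M"
proof -
  from w obtain D v where D: "D \<in> pert_set rs ms" "contraction D"
    and v: "eigenvector (scaled_prod e M D) v w"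
    by (auto simp: value_set_def spectrum_def eigenvalue_def spec_norm_le_1_iff)
  have Dc: "D \<in> carrier_mat n n" using pert_set_carrier[OF D(1)] n by simp
  \<comment> \<open>Scaling is treated as a degenerate linear combination of two admissible matrices.\<close>
  let ?E = "c \<cdot>\<^sub>m D + 0 \<cdot>\<^sub>m D"
  have "?E \<in> pert_set rs ms" by (rule pert_set_lincomb[OF D(1) D(1)])
  moreover have "contraction ?E" using contraction_convex[OF D(2) Dc D(2) Dc] c by simp
  moreover have "scaled_prod e M ?E = c \<cdot>\<^sub>m scaled_prod e M D"
    unfolding scaled_prod_lincomb[OF M Dc Dc] using M Dc by (auto simp: scaled_prod_def intro!: eq_matI)
  then have "eigenvector (scaled_prod e M ?E) v (c * w)"
    using v smult_mat_mult_vec[OF scaled_prod_carrier[OF M Dc, of e], of v c] scaled_prod_carrier[OF M Dc, of e]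
    by (auto simp: eigenvector_def smult_smult_assoc)
  ultimately show ?thesis
    by (auto simp: value_set_def spectrum_def eigenvalue_def spec_norm_le_1_iff)
qed

text \<open>
  In a set closed under multiplication by the unit disc, any element of modulus larger than \<open>\<bar>l\<bar>\<close>
  could be scaled down and rotated to the ray through \<open>l\<close>, ending up arbitrarily close to \<open>l\<close> and
  still of larger modulus.
\<close>

lemma local_max_modulus_imp_global:
  assumes scale: "\<And>w c. w \<in> X \<Longrightarrow> cmod c \<le> 1 \<Longrightarrow> c * w \<in> X"
    and l: "local_max_modulus X l" and w: "w \<in> X"
  shows "cmod w \<le> cmod l"
proof (rule ccontr)
  assume "\<not> ?thesis"
  then have lw: "cmod l < cmod w" by simp
  obtain d where d: "0 < d" and max: "\<And>w. w \<in> X \<Longrightarrow> dist w l < d \<Longrightarrow> cmod w \<le> cmod l"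
    using l by (auto simp: local_max_modulus_def)
  \<comment> \<open>The direction of \<open>l\<close>; any direction serves when \<open>l = 0\<close>.\<close>
  obtain e where e: "cmod e = 1" and le: "l = of_real (cmod l) * e"
  proof (cases "l = 0")
    case True then show ?thesis using that[of 1] by simp
  next
    case False
    then show ?thesis using that[of "l / of_real (cmod l)"] by (simp add: norm_divide)
  qed
  obtain r where r: "cmod l < r" "r < min (cmod w) (cmod l + d)"
    using dense[of "cmod l" "min (cmod w) (cmod l + d)"] lw d by auto
  have r0: "0 \<le> r" using r(1) norm_ge_zero[of l] by linarith
  have "(of_real r * e / w) * w \<in> X"
    using r r0 e by (intro scale w) (auto simp: norm_mult norm_divide divide_le_eq)
  moreover have "w \<noteq> 0" using lw norm_ge_zero[of l] by force
  ultimately have "of_real r * e \<in> X" by simp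
  moreover have "dist (of_real r * e) l = cmod ((of_real r - of_real (cmod l)) * e)"
    using le by (simp add: dist_norm algebra_simps)
  then have "dist (of_real r * e) l < d"
    using r e by (simp add: norm_mult flip: of_real_diff)
  ultimately have "r \<le> cmod l" using max r0 e by (fastforce simp: norm_mult)
  then show False using r by simp
qed

text \<open>
  Here \<open>Re_first_order_nonpos\<close> is applied to the segment from \<open>D\<close> to \<open>E\<close>; moving \<open>M\<close> to the other
  side of the inner product produces the vector \<open>z = M\<^sup>*y\<close>.
\<close>

lemma Re_inner_maximal:
  assumes M: "M \<in> carrier_mat n n" and D: "D \<in> carrier_mat n n" and E: "E \<in> carrier_mat n n"
    and \<epsilon>: "0 < \<epsilon>"
    and x: "eigenvector (scaled_prod \<epsilon> M D) x l" and y: "left_eigenvector (scaled_prod \<epsilon> M D) y l"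
    and simple: "order l (char_poly (scaled_prod \<epsilon> M D)) = 1"
    and l: "l = of_real r * e" and e: "cmod e = 1"
    and pos: "0 < e * (x \<bullet>c y)"
    and bound: "\<And>t a. 0 \<le> t \<Longrightarrow> t \<le> 1 \<Longrightarrow>
      eigenvalue (scaled_prod \<epsilon> M (of_real (1 - t) \<cdot>\<^sub>m D + of_real t \<cdot>\<^sub>m E)) a \<Longrightarrow> cmod a \<le> r"
  shows "Re ((E *\<^sub>v x) \<bullet>c (mat_adjoint M *\<^sub>v y)) \<le> Re ((D *\<^sub>v x) \<bullet>c (mat_adjoint M *\<^sub>v y))"
proof -
  let ?A = "scaled_prod \<epsilon> M D" and ?C = "scaled_prod \<epsilon> M E"
  let ?B = "?C - ?A"
  have A: "?A \<in> carrier_mat n n" and C: "?C \<in> carrier_mat n n" using M D E by auto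
  have xc: "x \<in> carrier_vec n" using x A by (auto simp: eigenvector_def)
  have yc: "y \<in> carrier_vec n" using y A by (auto simp: left_eigenvector_def)
  have path: "?A + of_real t \<cdot>\<^sub>m ?B = scaled_prod \<epsilon> M (of_real (1 - t) \<cdot>\<^sub>m D + of_real t \<cdot>\<^sub>m E)" for t
    unfolding scaled_prod_lincomb[OF M D E] using A C by (auto intro!: eq_matI simp: algebra_simps)
  have "Re ((?B *\<^sub>v x) \<bullet>c y) \<le> 0"
    by (rule Re_first_order_nonpos[OF A _ x y simple l e pos])
       (use A C bound in \<open>auto simp: path\<close>)
  moreover have "(scaled_prod \<epsilon> M F *\<^sub>v x) \<bullet>c y = of_real \<epsilon> * ((F *\<^sub>v x) \<bullet>c (mat_adjoint M *\<^sub>v y))"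
    if F: "F \<in> carrier_mat n n" for F
    unfolding scaled_prod_mult_vec[OF M F xc]
    using M F xc yc inner_mat_adjoint[OF M _ yc, of "F *\<^sub>v x"] by simp
  moreover have "(?B *\<^sub>v x) \<bullet>c y = (?C *\<^sub>v x) \<bullet>c y - (?A *\<^sub>v x) \<bullet>c y"
    unfolding minus_mult_distrib_mat_vec[OF C A xc]
    using A C xc yc by (intro minus_scalar_prod_distrib[of _ n]) auto
  ultimately have "\<epsilon> * (Re ((E *\<^sub>v x) \<bullet>c (mat_adjoint M *\<^sub>v y)) - Re ((D *\<^sub>v x) \<bullet>c (mat_adjoint M *\<^sub>v y))) \<le> 0"
    using D E by (simp add: right_diff_distrib)
  then show ?thesis using \<epsilon> by (simp add: mult_le_0_iff)
qed

section \<open>Blockwise maximality and the rank-one replacement\<close>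

lemma inner_mult_smult:
  fixes A :: "complex mat"
  assumes "A \<in> carrier_mat n m" "v \<in> carrier_vec m" "u \<in> carrier_vec n"
  shows "(A *\<^sub>v (a \<cdot>\<^sub>v v)) \<bullet>c (b \<cdot>\<^sub>v u) = a * cnj b * ((A *\<^sub>v v) \<bullet>c u)"
  using assms by (simp add: mult_mat_vec[of _ n m] conjugate_smult_vec)

lemma normalized:
  assumes "vnorm v \<noteq> 0"
  shows "vnorm ((1 / of_real (vnorm v)) \<cdot>\<^sub>v v) = 1"
    and "of_real (vnorm v) \<cdot>\<^sub>v ((1 / of_real (vnorm v)) \<cdot>\<^sub>v v) = v"
  using assms by (simp_all add: vnorm_smult norm_divide smult_smult_assoc)

text \<open>
  Exchanging one full block by another contraction keeps the perturbation admissible and changes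
  only one summand of the decoupled form.
\<close>

lemma block_pert_update_maximal:
  assumes parts: "block_parts rs ms ds Ds" and h: "h < length ms"
    and E: "E \<in> carrier_mat (ms ! h) (ms ! h)" "contraction E"
    and contr: "contraction (block_pert rs ds Ds)"
    and x: "x \<in> carrier_vec (sum_list (rs @ ms))" and z: "z \<in> carrier_vec (sum_list (rs @ ms))"
    and max: "\<And>D. D \<in> pert_set rs ms \<Longrightarrow> contraction D \<Longrightarrow>
      Re ((D *\<^sub>v x) \<bullet>c z) \<le> Re ((block_pert rs ds Ds *\<^sub>v x) \<bullet>c z)"
  defines "xh \<equiv> vec_block (rs @ ms) x (length rs + h)"
    and "zh \<equiv> vec_block (rs @ ms) z (length rs + h)"
  shows "Re ((E *\<^sub>v xh) \<bullet>c zh) \<le> Re ((Ds ! h *\<^sub>v xh) \<bullet>c zh)"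
proof -
  let ?L = "\<lambda>Ds. map2 (\<lambda>d r. d \<cdot>\<^sub>m 1\<^sub>m r) ds rs @ Ds" and ?ks = "rs @ ms"
  let ?Ds = "Ds[h := E]" and ?j = "length rs + h"
  let ?f = "\<lambda>Ds i. (?L Ds ! i *\<^sub>v vec_block ?ks x i) \<bullet>c vec_block ?ks z i"
  have len: "length ds = length rs" "length Ds = length ms" using parts by (auto simp: block_parts_def)
  have parts': "block_parts rs ms ds ?Ds" using parts E h by (auto simp: block_parts_def nth_list_update)
  note sq = list_all2_block_parts[OF parts] and sq' = list_all2_block_parts[OF parts']
  have "contraction (block_pert rs ds ?Ds)"
    using contr E(2) set_update_subset_insert[of Ds h E]
    unfolding block_pert_def contraction_diag_block_mat[OF sq] contraction_diag_block_mat[OF sq']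
    by auto
  then have "Re ((block_pert rs ds ?Ds *\<^sub>v x) \<bullet>c z) \<le> Re ((block_pert rs ds Ds *\<^sub>v x) \<bullet>c z)"
    using parts' by (intro max) (auto simp: pert_set_def)
  then have le: "Re (\<Sum>i<length ?ks. ?f ?Ds i) \<le> Re (\<Sum>i<length ?ks. ?f Ds i)"
    unfolding block_pert_def inner_diag_block_mat[OF sq x z] inner_diag_block_mat[OF sq' x z] .
  have j: "?j < length ?ks" using h by simp
  have rest: "?f ?Ds i = ?f Ds i" if "i \<noteq> ?j" for i
    using that len by (auto simp: nth_append nth_list_update)
  have split: "(\<Sum>i<length ?ks. F i) = F ?j + (\<Sum>i\<in>{..<length ?ks} - {?j}. F i)"
    for F :: "nat \<Rightarrow> complex"
    using j by (intro sum.remove) auto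
  have "(\<Sum>i\<in>{..<length ?ks} - {?j}. ?f ?Ds i) = (\<Sum>i\<in>{..<length ?ks} - {?j}. ?f Ds i)"
    using rest by (intro sum.cong) auto
  then have "Re (?f ?Ds ?j) \<le> Re (?f Ds ?j)"
    using le unfolding split by simp
  then show ?thesis using len h by (simp add: nth_append xh_def zh_def)
qed

theorem theorem3p4:
  fixes rs ms :: "nat list" and n :: nat and M :: "complex mat" and \<epsilon> :: real
    and ds :: "complex list" and Ds :: "complex mat list"
    and lam :: complex and \<theta> :: real and x y z :: "complex vec"
  defines "\<Delta>opt \<equiv> block_pert rs ds Ds"
    and "xb \<equiv> (\<lambda>h. vec_block (rs @ ms) x (length rs + h))"
    and "zb \<equiv> (\<lambda>h. vec_block (rs @ ms) z (length rs + h))"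
  assumes "\<forall>r\<in>set rs. 0 < r" and "\<forall>m\<in>set ms. 0 < m"
    and "sum_list rs + sum_list ms = n"
    and "M \<in> carrier_mat n n" and "0 < \<epsilon>"
    and "block_parts rs ms ds Ds"
    and "spec_norm \<Delta>opt = 1"
    and "local_extremizer rs ms \<epsilon> M \<Delta>opt"
    and "largest_eigenvalue (scaled_prod \<epsilon> M \<Delta>opt) lam"
    and "order lam (char_poly (scaled_prod \<epsilon> M \<Delta>opt)) = 1"
    and "lam = complex_of_real (cmod lam) * exp (\<i> * complex_of_real \<theta>)"
    and "eigenvector (scaled_prod \<epsilon> M \<Delta>opt) x lam"
    and "left_eigenvector (scaled_prod \<epsilon> M \<Delta>opt) y lam"
    and "0 < exp (\<i> * complex_of_real \<theta>) * (x \<bullet>c y)"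
    and "z = mat_adjoint M *\<^sub>v y"
    and "\<forall>h<length ms. vnorm (zb h) * vnorm (xb h) \<noteq> 0"
  shows "\<exists>\<gamma> :: nat \<Rightarrow> complex.
    let u = (\<lambda>h. (\<gamma> h / complex_of_real (vnorm (zb h))) \<cdot>\<^sub>v zb h);
        v = (\<lambda>h. (\<gamma> h / complex_of_real (vnorm (xb h))) \<cdot>\<^sub>v xb h);
        \<Delta>star = block_pert rs ds (map (\<lambda>h. outer (u h) (v h)) [0..<length ms])
    in (\<forall>h<length ms. cmod (\<gamma> h) = 1 \<and> singular_vectors_1 (Ds ! h) (u h) (v h)) \<and>
       local_extremizer rs ms \<epsilon> M \<Delta>star \<and>
       spectral_radius (scaled_prod \<epsilon> M \<Delta>opt) = spectral_radius (scaled_prod \<epsilon> M \<Delta>star)"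
proof -
  define u where "u h = (1 / complex_of_real (vnorm (zb h))) \<cdot>\<^sub>v zb h" for h
  define v where "v h = (1 / complex_of_real (vnorm (xb h))) \<cdot>\<^sub>v xb h" for h
  define \<Delta>star where "\<Delta>star = block_pert rs ds (map (\<lambda>h. outer (u h) (v h)) [0..<length ms])"
  note n = assms(6) and M = assms(7) and parts = assms(9) and x = assms(15) and y = assms(16)
    and z = assms(18)
  have len: "length ds = length rs" "length Ds = length ms" using parts by (auto simp: block_parts_def)
  have opt: "\<Delta>opt \<in> pert_set rs ms" "contraction \<Delta>opt"
    using parts assms(10) by (auto simp: \<Delta>opt_def pert_set_def spec_norm_le_1_iff[symmetric])
  have carrier: "D \<in> carrier_mat n n" if "D \<in> pert_set rs ms" for D
    using pert_set_carrier[OF that] n by simp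
  note optc = carrier[OF opt(1)]
  have xc: "x \<in> carrier_vec n" using x scaled_prod_carrier[OF M optc, of \<epsilon>] by (auto simp: eigenvector_def)
  have yc: "y \<in> carrier_vec n" using y scaled_prod_carrier[OF M optc, of \<epsilon>] by (auto simp: left_eigenvector_def)
  have zc: "z \<in> carrier_vec n" using z mat_adjoint_carrier[OF M] yc by simp

  \<comment> \<open>The extremal largest eigenvalue \<open>l\<close> may differ from \<open>lam\<close>, but has the same modulus.\<close>
  obtain l where l: "cmod l = cmod lam" "local_max_modulus (value_set rs ms \<epsilon> M) l"
    using assms(11,12) by (auto simp: local_extremizer_def largest_eigenvalue_def)
  have global: "cmod w \<le> cmod lam" if "w \<in> value_set rs ms \<epsilon> M" for w
    using local_max_modulus_imp_global[OF value_set_scale[OF M n[symmetric]] l(2) that] l(1) by simp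
  have bound: "cmod a \<le> cmod lam"
    if "D \<in> pert_set rs ms" "contraction D" "eigenvalue (scaled_prod \<epsilon> M D) a" for D a
    using that by (intro global) (auto simp: value_set_def spectrum_def spec_norm_le_1_iff)

  have max: "Re ((E *\<^sub>v x) \<bullet>c z) \<le> Re ((\<Delta>opt *\<^sub>v x) \<bullet>c z)"
    if E: "E \<in> pert_set rs ms" "contraction E" for E
    unfolding z
  proof (rule Re_inner_maximal[OF M optc carrier[OF E(1)] assms(8) x y assms(13,14) _ assms(17)])
    fix t :: real and a
    assume "0 \<le> t" "t \<le> 1"
      and "eigenvalue (scaled_prod \<epsilon> M (of_real (1 - t) \<cdot>\<^sub>m \<Delta>opt + of_real t \<cdot>\<^sub>m E)) a"
    moreover have "contraction (of_real (1 - t) \<cdot>\<^sub>m \<Delta>opt + of_real t \<cdot>\<^sub>m E)"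
      using \<open>0 \<le> t\<close> \<open>t \<le> 1\<close>
      by (intro contraction_convex[OF opt(2) optc E(2) carrier[OF E(1)]]) (simp del: of_real_diff)
    ultimately show "cmod a \<le> cmod lam"
      using bound pert_set_lincomb[OF opt(1) E(1)] by blast
  qed simp

  have xbc: "xb h \<in> carrier_vec (ms ! h)" and zbc: "zb h \<in> carrier_vec (ms ! h)" for h
    using vec_block_carrier[of "rs @ ms" _ "length rs + h"] by (auto simp: xb_def zb_def nth_append)
  have uc: "u h \<in> carrier_vec (ms ! h)" and vc: "v h \<in> carrier_vec (ms ! h)" for h
    using xbc zbc by (auto simp: u_def v_def)
  have unit: "vnorm (u h) = 1" "vnorm (v h) = 1"
    and xb: "xb h = of_real (vnorm (xb h)) \<cdot>\<^sub>v v h" and zb: "zb h = of_real (vnorm (zb h)) \<cdot>\<^sub>v u h"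
    if "h < length ms" for h
    using assms(19) that normalized[of "xb h"] normalized[of "zb h"] by (auto simp: u_def v_def)
  have outer_v: "outer (u h) (v h) *\<^sub>v v h = u h" if "h < length ms" for h
    using outer_mult_vec[OF vc vc, of "u h" h] vnorm_inner[of "v h"] unit[OF that] by simp
  have outer: "outer (u h) (v h) \<in> carrier_mat (ms ! h) (ms ! h)" for h
    using uc[of h] vc[of h] by (simp add: outer_def)

  have sing: "singular_vectors_1 (Ds ! h) (u h) (v h)" if h: "h < length ms" for h
  proof -
    have A: "Ds ! h \<in> carrier_mat (ms ! h) (ms ! h)" using parts h by (auto simp: block_parts_def)
    have "contraction (Ds ! h)"
      using opt(2) h len unfolding \<Delta>opt_def block_pert_def
        contraction_diag_block_mat[OF list_all2_block_parts[OF parts]] by auto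
    moreover have "1 \<le> Re ((Ds ! h *\<^sub>v v h) \<bullet>c u h)"
    proof -
      let ?a = "vnorm (xb h)" and ?b = "vnorm (zb h)"
      have scale: "Re ((E *\<^sub>v xb h) \<bullet>c zb h) = ?a * ?b * Re ((E *\<^sub>v v h) \<bullet>c u h)"
        if "E \<in> carrier_mat (ms ! h) (ms ! h)" for E
        using inner_mult_smult[OF that vc uc, of "of_real ?a" "of_real ?b"]
        unfolding xb[OF h, symmetric] zb[OF h, symmetric] by simp
      have pos: "0 < ?a * ?b" using assms(19) h vnorm_nonneg[of "xb h"] vnorm_nonneg[of "zb h"]
        by (auto simp: less_le)
      have "Re ((outer (u h) (v h) *\<^sub>v xb h) \<bullet>c zb h) \<le> Re ((Ds ! h *\<^sub>v xb h) \<bullet>c zb h)"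
        using block_pert_update_maximal[OF parts h outer contraction_outer[OF unit[OF h]]
            opt(2)[unfolded \<Delta>opt_def] _ _ max[unfolded \<Delta>opt_def]] xc zc n
        by (simp add: xb_def zb_def)
      moreover have "Re ((outer (u h) (v h) *\<^sub>v v h) \<bullet>c u h) = 1"
        using vnorm_inner[of "u h"] unit[OF h] by (simp add: outer_v[OF h])
      ultimately have "?a * ?b * 1 \<le> ?a * ?b * Re ((Ds ! h *\<^sub>v v h) \<bullet>c u h)"
        by (simp add: scale[OF A] scale[OF outer] del: times_complex.sel)
      then show ?thesis by (simp only: mult_le_cancel_left_pos[OF pos])
    qed
    ultimately show ?thesis using singular_vectors_1I[OF A] uc vc unit[OF h] by blast
  qed

  have parts': "block_parts rs ms ds (map (\<lambda>h. outer (u h) (v h)) [0..<length ms])"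
    using len outer by (auto simp: block_parts_def)
  have star: "\<Delta>star \<in> pert_set rs ms" using parts' by (auto simp: \<Delta>star_def pert_set_def)
  have star_contr: "contraction \<Delta>star"
    using opt(2) contraction_outer[OF unit]
    unfolding \<Delta>star_def \<Delta>opt_def block_pert_def
      contraction_diag_block_mat[OF list_all2_block_parts[OF parts]]
      contraction_diag_block_mat[OF list_all2_block_parts[OF parts']]
    by auto
  have "\<Delta>star *\<^sub>v x = \<Delta>opt *\<^sub>v x"
    unfolding \<Delta>star_def \<Delta>opt_def block_pert_def
  proof (rule diag_block_mat_mult_vec_cong[OF list_all2_block_parts[OF parts'] list_all2_block_parts[OF parts]])
    fix i assume i: "i < length (rs @ ms)"
    let ?L = "\<lambda>Ds. map2 (\<lambda>d r. d \<cdot>\<^sub>m 1\<^sub>m r) ds rs @ Ds"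
    show "?L (map (\<lambda>h. outer (u h) (v h)) [0..<length ms]) ! i *\<^sub>v vec_block (rs @ ms) x i
        = ?L Ds ! i *\<^sub>v vec_block (rs @ ms) x i"
    proof (cases "i < length rs")
      case True
      then show ?thesis using len by (simp add: nth_append)
    next
      case False
      define h where "h = i - length rs"
      have h: "h < length ms" and ih: "i = length rs + h" using False i by (auto simp: h_def)
      have A: "Ds ! h \<in> carrier_mat (ms ! h) (ms ! h)" using parts h by (auto simp: block_parts_def)
      have "outer (u h) (v h) *\<^sub>v xb h = Ds ! h *\<^sub>v xb h"
        using sing[OF h] outer_v[OF h]
        by (subst (1 2) xb[OF h]) (simp add: mult_mat_vec[OF A vc] mult_mat_vec[OF outer vc] singular_vectors_1_def)
      then show ?thesis using len h by (simp add: ih nth_append xb_def)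
    qed
  qed (use xc n in simp)
  then have "eigenvector (scaled_prod \<epsilon> M \<Delta>star) x lam"
    using x scaled_prod_carrier[OF M carrier[OF star], of \<epsilon>] scaled_prod_carrier[OF M optc, of \<epsilon>]
    by (auto simp: eigenvector_def scaled_prod_mult_vec[OF M carrier[OF star]] scaled_prod_mult_vec[OF M optc])
  then have ev: "eigenvalue (scaled_prod \<epsilon> M \<Delta>star) lam" by (auto simp: eigenvalue_def)
  have rad: "spectral_radius (scaled_prod \<epsilon> M \<Delta>star) = cmod lam"
    using spectral_radius_eqI[OF scaled_prod_carrier[OF M carrier[OF star]] ev]
      bound[OF star star_contr] by blast
  have "lam \<in> value_set rs ms \<epsilon> M"
    using star star_contr ev by (auto simp: value_set_def spectrum_def spec_norm_le_1_iff)
  then have "local_max_modulus (value_set rs ms \<epsilon> M) lam"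
    using global by (auto simp: local_max_modulus_def intro!: exI[of _ 1])
  then have "local_extremizer rs ms \<epsilon> M \<Delta>star"
    using star star_contr ev rad
    by (auto simp: local_extremizer_def largest_eigenvalue_def spec_norm_le_1_iff)
  moreover have "spectral_radius (scaled_prod \<epsilon> M \<Delta>opt) = cmod lam"
    using assms(12) by (simp add: largest_eigenvalue_def)
  ultimately show ?thesis
    using sing rad unfolding \<Delta>star_def u_def v_def
    by (intro exI[of _ "\<lambda>_. 1"]) (simp add: Let_def)
qed

end
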